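(* Let $X$ be a real Banach space and let $(\Omega,\Sigma,\mu)$ be a $\sigma$-finite measure space with $\mu(\Omega)>0$. Then $X$ has the property $( ** )$ if and only if $L_1(\mu,X)$ has the property $( ** )$.
   Context: All Banach spaces are real. For a Banach space $Z$, $B_Z$, $S_Z$ and $Z^*$ denote its closed unit ball, unit sphere and dual. For $z^*\in S_{Z^*}$ and $0<\alpha<1$, the slice is $S(z^*,\alpha)=\{z\in B_Z: z^*(z)>1-\alpha\}$, and $-S(z^*,\alpha)=\{-z: z\in S(z^*,\alpha)\}$. A Banach space $Z$ has the property $( ** )$ if for all $z_1,z_2\in S_Z$ and every $\varepsilon>0$ there exists $z^*\in S_{Z^*}$ such that, writing $S=S(z^*,\varepsilon)$, one has $z_1\in S$ and $\operatorname{dist}(z_2,S)+\operatorname{dist}(z_2,-S)<2+\varepsilon$. $L_1(\mu,X)$ is the Banach space of (classes of) Bochner-integrable functions $\Omega\to X$ with norm $\|f\|_1=\int_\Omega\|f(t)\|\,d\mu(t)$. *)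

theory Defs
  imports "HOL-Analysis.Analysis"
begin

text \<open>An abstract (semi)normed real vector space is given by a carrier V,
 addition pl, scalar multiplication sc and a (semi)norm N.
 Difference z - s is pl z (sc (-1) s).\<close>

definition ns_dist :: "('v \<Rightarrow> 'v \<Rightarrow> 'v) \<Rightarrow> (real \<Rightarrow> 'v \<Rightarrow> 'v) \<Rightarrow> ('v \<Rightarrow> real)
    \<Rightarrow> 'v \<Rightarrow> 'v set \<Rightarrow> real" where
  "ns_dist pl sc N z S = Inf ((\<lambda>s. N (pl z (sc (-1) s))) ` S)"

text \<open>Norm-one continuous linear functionals (unit sphere of the dual).\<close>
definition dual_sphere :: "'v set \<Rightarrow> ('v \<Rightarrow> 'v \<Rightarrow> 'v) \<Rightarrow> (real \<Rightarrow> 'v \<Rightarrow> 'v)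
    \<Rightarrow> ('v \<Rightarrow> real) \<Rightarrow> ('v \<Rightarrow> real) set" where
  "dual_sphere V pl sc N = {\<phi>.
      (\<forall>x\<in>V. \<forall>y\<in>V. \<phi> (pl x y) = \<phi> x + \<phi> y) \<and>
      (\<forall>c. \<forall>x\<in>V. \<phi> (sc c x) = c * \<phi> x) \<and>
      (\<forall>x\<in>V. \<bar>\<phi> x\<bar> \<le> N x) \<and>
      (\<forall>\<delta>>0. \<exists>x\<in>V. N x \<le> 1 \<and> \<phi> x > 1 - \<delta>)}"

definition slice_on :: "'v set \<Rightarrow> ('v \<Rightarrow> real) \<Rightarrow> ('v \<Rightarrow> real) \<Rightarrow> real \<Rightarrow> 'v set" where
  "slice_on V N \<phi> \<alpha> = {z\<in>V. N z \<le> 1 \<and> \<phi> z > 1 - \<alpha>}"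

definition prop_star_on :: "'v set \<Rightarrow> ('v \<Rightarrow> 'v \<Rightarrow> 'v) \<Rightarrow> (real \<Rightarrow> 'v \<Rightarrow> 'v)
    \<Rightarrow> ('v \<Rightarrow> real) \<Rightarrow> bool" where
  "prop_star_on V pl sc N \<longleftrightarrow>
    (\<forall>z1\<in>V. \<forall>z2\<in>V. N z1 = 1 \<longrightarrow> N z2 = 1 \<longrightarrow> (\<forall>\<epsilon>>0.
      (\<exists>\<phi>\<in>dual_sphere V pl sc N.
         z1 \<in> slice_on V N \<phi> \<epsilon> \<and>
         ns_dist pl sc N z2 (slice_on V N \<phi> \<epsilon>)
           + ns_dist pl sc N z2 (sc (-1) ` slice_on V N \<phi> \<epsilon>) < 2 + \<epsilon>)))"

text \<open>Property (**) for a Banach space type.\<close>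
definition prop_star :: "'a::real_normed_vector itself \<Rightarrow> bool" where
  "prop_star _ \<longleftrightarrow> prop_star_on (UNIV::'a set) (+) (*\<^sub>R) norm"

text \<open>Strongly measurable: pointwise limit on the space of simple functions.\<close>
definition strongly_measurable :: "'b measure \<Rightarrow> ('b \<Rightarrow> 'a::real_normed_vector) \<Rightarrow> bool" where
  "strongly_measurable M f \<longleftrightarrow>
    (\<exists>s::nat \<Rightarrow> 'b \<Rightarrow> 'a. (\<forall>n. simple_function M (s n)) \<and>
       (\<forall>t\<in>space M. (\<lambda>n. s n t) \<longlonglongrightarrow> f t))"

text \<open>Bochner integrable functions (representatives; classes are identified via the seminorm).\<close>
definition L1_set :: "'b measure \<Rightarrow> ('b \<Rightarrow> 'a::real_normed_vector) set" where
  "L1_set M = {f. strongly_measurable M f \<and> (\<integral>\<^sup>+ t. ennreal (norm (f t)) \<partial>M) < \<infinity>}"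

definition L1_norm :: "'b measure \<Rightarrow> ('b \<Rightarrow> 'a::real_normed_vector) \<Rightarrow> real" where
  "L1_norm M f = enn2real (\<integral>\<^sup>+ t. ennreal (norm (f t)) \<partial>M)"

definition prop_star_L1 :: "'b measure \<Rightarrow> 'a::real_normed_vector itself \<Rightarrow> bool" where
  "prop_star_L1 M _ \<longleftrightarrow>
     prop_star_on (L1_set M :: ('b \<Rightarrow> 'a) set) (\<lambda>f g t. f t + g t) (\<lambda>c f t. c *\<^sub>R f t) (L1_norm M)"

end

theory Submission
  imports Defs
begin

text \<open>If \<open>X\<close> has (**), approximate \<open>f1\<close> and \<open>f2\<close> by simple functions and apply (**) on the unit
  directions of each pair of values; the functionals \<open>\<psi>\<^sub>t\<close> so obtained take finitely many values
  and glue to \<open>f \<mapsto> \<integral> \<psi>\<^sub>t (f t) d\<mu>\<close>.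

  Conversely, test \<open>L\<^sub>1\<close> on \<open>x1 \<chi>\<^sub>A / \<mu>(A)\<close> and \<open>x2 \<chi>\<^sub>A / \<mu>(A)\<close>. Since
  \<open>\<parallel>f2 + h\<parallel> \<ge> \<phi>(f2 + h)\<close> for \<open>h\<close> in the slice, the distance estimate gives
  \<open>\<parallel>g - f2\<parallel> \<le> \<phi>(g - f2)\<close> up to a small error, so \<open>\<phi>\<close> almost attains its norm at \<open>g\<close>, at
  \<open>g - f2\<close> and at \<open>f1\<close>. These three defects are integrals of nonnegative quantities; averaging
  them together with \<open>\<parallel>g\<parallel>\<close> over the level sets of a simple \<open>g\<close> yields a functional \<open>\<psi>\<close> on \<open>X\<close>
  and a vector \<open>G\<close> with \<open>\<parallel>G\<parallel> \<le> 1\<close> such that \<open>\<psi>\<close> almost attains its norm at \<open>x1\<close>, \<open>G\<close> and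
  \<open>H = G - x2\<close>. Averaging cannot bound \<open>\<parallel>g\<parallel>\<close> and \<open>\<parallel>h\<parallel>\<close> at the same point of a nonatomic space,
  so \<open>\<parallel>H\<parallel> \<approx> \<psi>(G) - \<psi>(x2) \<le> 1\<close> is obtained otherwise: \<open>x1\<close> is first moved slightly towards \<open>x2\<close>
  or \<open>-x2\<close>, whichever does not decrease the norm, and this forces \<open>\<psi>(x2) \<ge> 0\<close> up to a small error
  (after replacing \<open>x2\<close> by \<open>-x2\<close> if necessary). Adding multiples of \<open>x1\<close> to \<open>G\<close> and \<open>H\<close> then
  produces the points of the slice.\<close>

section \<open>Strong measurability and the L1 seminorm\<close>

lemma simple_imp_strongly_measurable:
  "simple_function M f \<Longrightarrow> strongly_measurable M f"
  unfolding strongly_measurable_def by (rule exI[of _ "\<lambda>_. f"]) auto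

lemma strongly_measurable_add:
  assumes "strongly_measurable M f" "strongly_measurable M g"
  shows "strongly_measurable M (\<lambda>t. f t + g t)"
proof -
  obtain s r where "\<And>n. simple_function M (s n)" "\<And>t. t \<in> space M \<Longrightarrow> (\<lambda>n. s n t) \<longlonglongrightarrow> f t"
    "\<And>n. simple_function M (r n)" "\<And>t. t \<in> space M \<Longrightarrow> (\<lambda>n. r n t) \<longlonglongrightarrow> g t"
    using assms unfolding strongly_measurable_def by blast
  then show ?thesis unfolding strongly_measurable_def
    by (intro exI[of _ "\<lambda>n t. s n t + r n t"])
      (simp add: simple_function_compose2[where h = "(+)"] tendsto_add)
qed

text \<open>Only \<open>f\<close> is approximated by simple functions while \<open>p\<close> stays
  fixed, so continuity of each \<open>\<Phi> c\<close> separately suffices. This gives measurability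
  of glued functionals and of products with indicators.\<close>

lemma strongly_measurable_simple_family:
  assumes f: "strongly_measurable M f" and p: "simple_function M p"
    and cont: "\<And>c. continuous_on UNIV (\<Phi> c)"
  shows "strongly_measurable M (\<lambda>t. \<Phi> (p t) (f t))"
proof -
  obtain s where s: "\<And>n. simple_function M (s n)"
      "\<And>t. t \<in> space M \<Longrightarrow> (\<lambda>n. s n t) \<longlonglongrightarrow> f t"
    using f unfolding strongly_measurable_def by blast
  have "(\<lambda>n. \<Phi> (p t) (s n t)) \<longlonglongrightarrow> \<Phi> (p t) (f t)" if "t \<in> space M" for t
    using continuous_on_tendsto_compose[OF cont s(2)[OF that]] by auto
  then show ?thesis unfolding strongly_measurable_def
    by (intro exI[of _ "\<lambda>n t. \<Phi> (p t) (s n t)"])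
      (simp add: simple_function_compose2[where h = \<Phi>] p s)
qed

lemma strongly_measurable_compose:
  assumes "strongly_measurable M f" "continuous_on UNIV \<Phi>"
  shows "strongly_measurable M (\<lambda>t. \<Phi> (f t))"
  using strongly_measurable_simple_family[OF assms(1) simple_function_const, of "\<lambda>_. \<Phi>"] assms(2)
  by simp

lemma continuous_on_scaleR_const:
  fixes S :: "'a::real_normed_vector set"
  shows "continuous_on S ((*\<^sub>R) c)"
  by (rule continuous_on_scaleR[OF continuous_on_const continuous_on_id])

lemma strongly_measurable_real:
  fixes f :: "_ \<Rightarrow> real"
  assumes "strongly_measurable M f"
  shows "f \<in> borel_measurable M"
proof -
  obtain s where s: "\<And>n. simple_function M (s n)"
      "\<And>t. t \<in> space M \<Longrightarrow> (\<lambda>n. s n t) \<longlonglongrightarrow> f t"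
    using assms unfolding strongly_measurable_def by blast
  show ?thesis
    by (rule borel_measurable_LIMSEQ_real[OF s(2) borel_measurable_simple_function[OF s(1)]])
qed

lemma borel_measurable_norm_strongly:
  "strongly_measurable M f \<Longrightarrow> (\<lambda>t. norm (f t)) \<in> borel_measurable M"
  by (rule strongly_measurable_real[OF strongly_measurable_compose[OF _ continuous_on_norm_id]])

lemma L1_set_iff:
  "f \<in> L1_set M \<longleftrightarrow> strongly_measurable M f \<and> integrable M (\<lambda>t. norm (f t))"
  unfolding L1_set_def using borel_measurable_norm_strongly[of M f]
  by (auto simp: integrable_iff_bounded)

lemma L1_norm_eq_integral:
  assumes "f \<in> L1_set M"
  shows "L1_norm M f = (\<integral>t. norm (f t) \<partial>M)"
  unfolding L1_norm_def using assms
  by (subst integral_eq_nn_integral)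
     (simp_all add: L1_set_iff borel_measurable_norm_strongly)

lemma L1_norm_nonneg [simp]: "0 \<le> L1_norm M f"
  unfolding L1_norm_def by simp

lemma L1_set_dominated:
  assumes "strongly_measurable M f" "integrable M w" "\<And>t. t \<in> space M \<Longrightarrow> norm (f t) \<le> w t"
  shows "f \<in> L1_set M"
  unfolding L1_set_iff
proof
  show "integrable M (\<lambda>t. norm (f t))"
  proof (rule Bochner_Integration.integrable_bound[OF assms(2)])
    show "(\<lambda>t. norm (f t)) \<in> borel_measurable M"
      by (rule borel_measurable_norm_strongly[OF assms(1)])
    show "AE t in M. norm (norm (f t)) \<le> norm (w t)"
      using assms(3) by (intro AE_I2) fastforce
  qed
qed fact

lemma L1_set_add:
  assumes "f \<in> L1_set M" "g \<in> L1_set M"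
  shows "(\<lambda>t. f t + g t) \<in> L1_set M"
  by (rule L1_set_dominated[where w = "\<lambda>t. norm (f t) + norm (g t)"])
     (use assms in \<open>simp_all add: L1_set_iff strongly_measurable_add norm_triangle_ineq\<close>)

lemma L1_set_scaleR:
  assumes "f \<in> L1_set M"
  shows "(\<lambda>t. c *\<^sub>R f t) \<in> L1_set M"
  by (rule L1_set_dominated[where w = "\<lambda>t. \<bar>c\<bar> * norm (f t)"])
     (use assms in \<open>simp_all add: L1_set_iff strongly_measurable_compose[OF _ continuous_on_scaleR_const]\<close>)

lemma L1_set_diff:
  assumes "f \<in> L1_set M" "g \<in> L1_set M"
  shows "(\<lambda>t. f t - g t) \<in> L1_set M"
  using L1_set_add[OF assms(1) L1_set_scaleR[OF assms(2), of "-1"]] by simp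

lemma L1_norm_scaleR:
  assumes "f \<in> L1_set M"
  shows "L1_norm M (\<lambda>t. c *\<^sub>R f t) = \<bar>c\<bar> * L1_norm M f"
  using assms by (simp add: L1_norm_eq_integral L1_set_scaleR)

lemma L1_norm_triangle:
  assumes "f \<in> L1_set M" "g \<in> L1_set M"
  shows "L1_norm M (\<lambda>t. f t + g t) \<le> L1_norm M f + L1_norm M g"
proof -
  have "(\<integral>t. norm (f t + g t) \<partial>M) \<le> (\<integral>t. norm (f t) + norm (g t) \<partial>M)"
    using assms L1_set_add[OF assms]
    by (intro integral_mono) (auto simp: L1_set_iff norm_triangle_ineq)
  then show ?thesis
    using assms L1_norm_eq_integral[OF L1_set_add[OF assms]]
    by (simp add: L1_norm_eq_integral) (simp add: L1_set_iff)
qed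

lemma L1_norm_mono:
  assumes "f \<in> L1_set M" "g \<in> L1_set M" "\<And>t. norm (f t) \<le> norm (g t)"
  shows "L1_norm M f \<le> L1_norm M g"
  unfolding L1_norm_eq_integral[OF assms(1)] L1_norm_eq_integral[OF assms(2)]
  by (intro integral_mono) (use assms in \<open>simp_all add: L1_set_iff\<close>)

lemma L1_norm_diff_commute: "L1_norm M (\<lambda>t. f t - g t) = L1_norm M (\<lambda>t. g t - f t)"
  unfolding L1_norm_def by (simp add: norm_minus_commute)

lemma L1_set_indicator:
  assumes "f \<in> L1_set M" "A \<in> sets M"
  shows "(\<lambda>t. indicator A t *\<^sub>R f t) \<in> L1_set M"
proof (rule L1_set_dominated[where w = "\<lambda>t. norm (f t)"])
  show "strongly_measurable M (\<lambda>t. indicator A t *\<^sub>R f t)"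
    using assms by (intro strongly_measurable_simple_family[of M f "indicator A" "(*\<^sub>R)"])
      (simp_all add: L1_set_iff continuous_on_scaleR_const)
  show "norm (indicator A t *\<^sub>R f t) \<le> norm (f t)" for t
    by (simp add: indicator_def)
qed (use assms in \<open>simp add: L1_set_iff\<close>)

lemma L1_set_simple_indicator:
  fixes k :: "'b \<Rightarrow> 'a::real_normed_vector"
  assumes k: "simple_function M k" and A: "A \<in> sets M" "emeasure M A < \<infinity>"
  shows "(\<lambda>t. indicator A t *\<^sub>R k t) \<in> L1_set M"
proof (rule L1_set_dominated[where w = "\<lambda>t. indicator A t * Max (insert 0 (norm ` k ` space M))"])
  show "strongly_measurable M (\<lambda>t. indicator A t *\<^sub>R k t)"
    by (rule simple_imp_strongly_measurable)
      (rule simple_function_compose2[OF simple_function_indicator[OF A(1)] k, where h = "(*\<^sub>R)"])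
  show "integrable M (\<lambda>t. indicator A t * Max (insert 0 (norm ` k ` space M)))"
    using A by (intro integrable_mult_left integrable_real_indicator) auto
  show "norm (indicator A t *\<^sub>R k t) \<le> indicator A t * Max (insert 0 (norm ` k ` space M))"
    if "t \<in> space M" for t
    using k that by (simp add: simple_function_def indicator_def Max_ge)
qed

section \<open>Approximation by simple functions\<close>

lemma L1_simple_approx:
  fixes f :: "'b \<Rightarrow> 'a::real_normed_vector"
  assumes f: "f \<in> L1_set M" and "\<delta> > 0"
  obtains k where "simple_function M k" "k \<in> L1_set M" "L1_norm M (\<lambda>t. f t - k t) < \<delta>"
proof -
  obtain s where s: "\<And>n. simple_function M (s n)"
      "\<And>t. t \<in> space M \<Longrightarrow> (\<lambda>n. s n t) \<longlonglongrightarrow> f t"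
    using f unfolding L1_set_iff strongly_measurable_def by blast
  have fm [measurable]: "(\<lambda>t. norm (f t)) \<in> borel_measurable M"
    using f by (simp add: L1_set_iff borel_measurable_norm_strongly)
  \<comment> \<open>Discarding values of \<open>s n\<close> larger than twice
    \<open>norm (f t)\<close> keeps the functions simple and gives the majorant
    \<open>3 * norm (f t)\<close> for dominated convergence. Where \<open>f t = 0\<close> this
    forces \<open>k n t = 0\<close>; elsewhere the factor 2 makes the truncation eventually
    inactive.\<close>
  define k where "k n t = (if norm (s n t) \<le> 2 * norm (f t) then s n t else 0)" for n t
  have [measurable]: "(\<lambda>t. norm (s n t)) \<in> borel_measurable M" for n
    by (rule borel_measurable_simple_function[OF simple_function_compose1[OF s(1)]])
  have ksimple: "simple_function M (k n)" for n
    unfolding k_def by (rule simple_function_If[OF s(1) simple_function_const]) measurable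
  have kle: "norm (k n t) \<le> 2 * norm (f t)" for n t
    by (auto simp: k_def)
  have kL: "k n \<in> L1_set M" for n
    by (rule L1_set_dominated[where w = "\<lambda>t. 2 * norm (f t)"])
       (use f ksimple kle in \<open>simp_all add: L1_set_iff simple_imp_strongly_measurable\<close>)
  have klim: "(\<lambda>n. norm (f t - k n t)) \<longlonglongrightarrow> 0" if t: "t \<in> space M" for t
  proof (cases "f t = 0")
    case True
    then have "k n t = 0" for n by (simp add: k_def)
    then show ?thesis using True by simp
  next
    case False
    have "(\<lambda>n. norm (s n t)) \<longlonglongrightarrow> norm (f t)"
      by (intro tendsto_intros s t)
    then have "eventually (\<lambda>n. norm (s n t) < 2 * norm (f t)) sequentially"
      using False by (intro order_tendstoD) auto
    then have "eventually (\<lambda>n. norm (f t - s n t) = norm (f t - k n t)) sequentially"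
      by eventually_elim (auto simp: k_def)
    moreover have "(\<lambda>n. norm (f t - s n t)) \<longlonglongrightarrow> norm (f t - f t)"
      by (intro tendsto_intros s t)
    ultimately show ?thesis by (simp add: Lim_transform_eventually)
  qed
  have "(\<lambda>n. \<integral>t. norm (f t - k n t) \<partial>M) \<longlonglongrightarrow> (\<integral>t. 0 \<partial>M)"
  proof (rule integral_dominated_convergence[where w = "\<lambda>t. 3 * norm (f t)"])
    show "integrable M (\<lambda>t. 3 * norm (f t))" using f by (auto simp: L1_set_iff)
    show "(\<lambda>t. norm (f t - k n t)) \<in> borel_measurable M" for n
      using L1_set_diff[OF f kL] by (auto simp: L1_set_iff)
    show "AE t in M. (\<lambda>n. norm (f t - k n t)) \<longlonglongrightarrow> 0" using klim by auto
    show "AE t in M. norm (norm (f t - k n t)) \<le> 3 * norm (f t)" for n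
    proof (rule AE_I2)
      fix t
      show "norm (norm (f t - k n t)) \<le> 3 * norm (f t)"
        using kle[of n t] norm_triangle_ineq4[of "f t" "k n t"] by simp
    qed
  qed auto
  then have "eventually (\<lambda>n. (\<integral>t. norm (f t - k n t) \<partial>M) < \<delta>) sequentially"
    using \<open>\<delta> > 0\<close> by (intro order_tendstoD(2)) auto
  then obtain n where "(\<integral>t. norm (f t - k n t) \<partial>M) < \<delta>"
    by (auto simp: eventually_sequentially)
  then show ?thesis
    using that[OF ksimple kL] by (simp add: L1_norm_eq_integral L1_set_diff f kL)
qed

text \<open>Dividing an approximant \<open>k\<close> by its norm \<open>n\<close> moves it by
  \<open>\<bar>n - 1\<bar>\<close>, which the triangle inequality bounds by the error already made.
  Hence two errors \<open>\<eta>\<close> with \<open>2 * \<eta> \<le> \<delta>\<close>; the cap 1/2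
  on \<open>\<eta>\<close> keeps \<open>n\<close> positive.\<close>

lemma L1_simple_approx_unit:
  fixes f :: "'b \<Rightarrow> 'a::real_normed_vector"
  assumes f: "f \<in> L1_set M" "L1_norm M f = 1" and "\<delta> > 0"
  obtains k where "simple_function M k" "k \<in> L1_set M" "L1_norm M k = 1"
    "L1_norm M (\<lambda>t. f t - k t) < \<delta>"
proof -
  define \<eta> where "\<eta> = min (\<delta>/2) (1/2)"
  have \<eta>: "0 < \<eta>" "\<eta> \<le> 1/2" "2 * \<eta> \<le> \<delta>" using \<open>\<delta> > 0\<close> by (auto simp: \<eta>_def)
  obtain k where k: "simple_function M k" "k \<in> L1_set M" "L1_norm M (\<lambda>t. f t - k t) < \<eta>"
    using L1_simple_approx[OF f(1) \<eta>(1)] by blast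
  define n where "n = L1_norm M k"
  have "1 \<le> L1_norm M (\<lambda>t. f t - k t) + n"
    using L1_norm_triangle[OF L1_set_diff[OF f(1) k(2)] k(2)] f(2) by (simp add: n_def)
  moreover have "n \<le> L1_norm M (\<lambda>t. k t - f t) + 1"
    using L1_norm_triangle[OF L1_set_diff[OF k(2) f(1)] f(1)] f(2) by (simp add: n_def)
  ultimately have n: "\<bar>n - 1\<bar> < \<eta>" "n > 0"
    using k(3) \<eta> by (auto simp: L1_norm_diff_commute[of M k f])
  define k' where "k' t = (1/n) *\<^sub>R k t" for t
  have k'L: "k' \<in> L1_set M" unfolding k'_def by (rule L1_set_scaleR[OF k(2)])
  have "L1_norm M (\<lambda>t. k t - k' t) = L1_norm M (\<lambda>t. (1 - 1/n) *\<^sub>R k t)"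
    by (simp add: k'_def scaleR_diff_left)
  also have "\<dots> = \<bar>1 - 1/n\<bar> * n" by (simp add: L1_norm_scaleR k n_def)
  also have "\<dots> = \<bar>n - 1\<bar>" using n(2) by (simp add: abs_if field_simps)
  finally have "L1_norm M (\<lambda>t. k t - k' t) < \<eta>" using n by simp
  then have "L1_norm M (\<lambda>t. f t - k' t) < \<delta>"
    using L1_norm_triangle[OF L1_set_diff[OF f(1) k(2)] L1_set_diff[OF k(2) k'L]] k(3) \<eta> by simp
  moreover have "simple_function M k'"
    unfolding k'_def by (rule simple_function_compose1[OF k(1)])
  moreover have "L1_norm M k' = 1"
    unfolding k'_def using n k by (simp add: L1_norm_scaleR n_def)
  ultimately show ?thesis using that k'L by blast
qed

section \<open>The property restated through points of the slice\<close>

lemma cInf_add_less_iff: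
  fixes A B :: "real set"
  assumes "A \<noteq> {}" "B \<noteq> {}" "\<And>x. x \<in> A \<Longrightarrow> 0 \<le> x" "\<And>x. x \<in> B \<Longrightarrow> 0 \<le> x"
  shows "Inf A + Inf B < c \<longleftrightarrow> (\<exists>a\<in>A. \<exists>b\<in>B. a + b < c)"
proof
  have bdd: "bdd_below A" "bdd_below B"
    using bdd_belowI[of A 0] bdd_belowI[of B 0] assms(3,4) by simp_all
  {
    assume less: "Inf A + Inf B < c"
    \<comment> \<open>The infima need not be attained, so each may be exceeded by less than half of
      the gap.\<close>
    define d where "d = (c - Inf A - Inf B) / 2"
    have "Inf A < Inf A + d" "Inf B < Inf B + d" using less by (auto simp: d_def)
    then obtain a b where "a \<in> A" "a < Inf A + d" "b \<in> B" "b < Inf B + d"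
      using cInf_less_iff bdd assms by meson
    then show "\<exists>a\<in>A. \<exists>b\<in>B. a + b < c"
      by (intro bexI[of _ a] bexI[of _ b]) (auto simp: d_def field_simps)
  }
  show "\<exists>a\<in>A. \<exists>b\<in>B. a + b < c \<Longrightarrow> Inf A + Inf B < c"
    using bdd by (meson add_mono cInf_lower le_less_trans)
qed

lemma ns_dist_add_less_iff:
  assumes "\<And>x. 0 \<le> N x" "S \<noteq> {}"
  shows "ns_dist pl sc N z S + ns_dist pl sc N z (sc (-1) ` S) < c \<longleftrightarrow>
    (\<exists>g\<in>S. \<exists>h\<in>S. N (pl z (sc (-1) g)) + N (pl z (sc (-1) (sc (-1) h))) < c)"
  unfolding ns_dist_def by (subst cInf_add_less_iff) (use assms in auto)

text \<open>Each distance is replaced by a witness in the slice. \<open>Inf\<close> is meaningful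
  here because the slice is nonempty: it contains \<open>z1\<close>, and if it does not, both sides
  fail.\<close>

lemma prop_star_on_iff:
  assumes "\<And>x. 0 \<le> N x"
  shows "prop_star_on V pl sc N \<longleftrightarrow>
    (\<forall>z1\<in>V. \<forall>z2\<in>V. N z1 = 1 \<longrightarrow> N z2 = 1 \<longrightarrow> (\<forall>\<epsilon>>0.
      (\<exists>\<phi>\<in>dual_sphere V pl sc N. \<phi> z1 > 1 - \<epsilon> \<and>
        (\<exists>g\<in>V. \<exists>h\<in>V. N g \<le> 1 \<and> N h \<le> 1 \<and> \<phi> g > 1 - \<epsilon> \<and> \<phi> h > 1 - \<epsilon> \<and>
          N (pl z2 (sc (-1) g)) + N (pl z2 (sc (-1) (sc (-1) h))) < 2 + \<epsilon>))))"
proof -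
  have eq: "(z1 \<in> slice_on V N \<phi> \<epsilon> \<and>
         ns_dist pl sc N z2 (slice_on V N \<phi> \<epsilon>)
           + ns_dist pl sc N z2 (sc (-1) ` slice_on V N \<phi> \<epsilon>) < 2 + \<epsilon>) \<longleftrightarrow>
      \<phi> z1 > 1 - \<epsilon> \<and>
        (\<exists>g\<in>V. \<exists>h\<in>V. N g \<le> 1 \<and> N h \<le> 1 \<and> \<phi> g > 1 - \<epsilon> \<and> \<phi> h > 1 - \<epsilon> \<and>
          N (pl z2 (sc (-1) g)) + N (pl z2 (sc (-1) (sc (-1) h))) < 2 + \<epsilon>)"
    if z1: "z1 \<in> V" "N z1 = 1" for z1 z2 \<phi> \<epsilon>
  proof (cases "\<phi> z1 > 1 - \<epsilon>")
    case True
    then have "z1 \<in> slice_on V N \<phi> \<epsilon>" using z1 by (auto simp: slice_on_def)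
    moreover from this have "slice_on V N \<phi> \<epsilon> \<noteq> {}" by blast
    ultimately show ?thesis
      using True by (simp add: ns_dist_add_less_iff assms) (auto simp: slice_on_def)
  qed (auto simp: slice_on_def)
  show ?thesis
    unfolding prop_star_on_def
    by (intro ball_cong all_cong1 imp_cong refl bex_cong) (rule eq)
qed

lemma prop_star_iff:
  "prop_star TYPE('a::real_normed_vector) \<longleftrightarrow>
    (\<forall>z1 z2 :: 'a. norm z1 = 1 \<longrightarrow> norm z2 = 1 \<longrightarrow> (\<forall>\<epsilon>>0.
      (\<exists>\<phi>\<in>dual_sphere UNIV (+) (*\<^sub>R) norm. \<phi> z1 > 1 - \<epsilon> \<and>
        (\<exists>g h. norm g \<le> 1 \<and> norm h \<le> 1 \<and> \<phi> g > 1 - \<epsilon> \<and> \<phi> h > 1 - \<epsilon> \<and>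
          norm (z2 - g) + norm (z2 + h) < 2 + \<epsilon>))))"
  unfolding prop_star_def prop_star_on_iff[of norm, OF norm_ge_zero]
  by (simp only: ball_UNIV bex_UNIV scaleR_minus1_left minus_minus add_uminus_conv_diff)

abbreviation L1_dual_sphere :: "'b measure \<Rightarrow> (('b \<Rightarrow> 'a::real_normed_vector) \<Rightarrow> real) set" where
  "L1_dual_sphere M \<equiv> dual_sphere (L1_set M) (\<lambda>f g t. f t + g t) (\<lambda>c f t. c *\<^sub>R f t) (L1_norm M)"

lemma prop_star_L1_iff:
  "prop_star_L1 M TYPE('a::real_normed_vector) \<longleftrightarrow>
    (\<forall>z1\<in>L1_set M. \<forall>z2\<in>L1_set M. L1_norm M z1 = 1 \<longrightarrow> L1_norm M z2 = 1 \<longrightarrow> (\<forall>\<epsilon>>0.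
      (\<exists>\<phi>::(_ \<Rightarrow> 'a) \<Rightarrow> real\<in>L1_dual_sphere M. \<phi> z1 > 1 - \<epsilon> \<and>
        (\<exists>g\<in>L1_set M. \<exists>h\<in>L1_set M. L1_norm M g \<le> 1 \<and> L1_norm M h \<le> 1 \<and> \<phi> g > 1 - \<epsilon> \<and> \<phi> h > 1 - \<epsilon> \<and>
          L1_norm M (\<lambda>t. z2 t - g t) + L1_norm M (\<lambda>t. z2 t + h t) < 2 + \<epsilon>))))"
  unfolding prop_star_L1_def prop_star_on_iff[of "L1_norm M", OF L1_norm_nonneg]
  by (simp only: scaleR_minus1_left minus_minus add_uminus_conv_diff)

section \<open>Norm-one functionals, and the passage from \<open>X\<close> to L1\<close>

lemma dual_sphere_UNIV_iff:
  "\<phi> \<in> dual_sphere (UNIV :: 'a::real_normed_vector set) (+) (*\<^sub>R) norm \<longleftrightarrow>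
    linear \<phi> \<and> (\<forall>x. \<bar>\<phi> x\<bar> \<le> norm x) \<and> (\<forall>\<delta>>0. \<exists>x. norm x \<le> 1 \<and> \<phi> x > 1 - \<delta>)"
  by (simp add: dual_sphere_def linear_iff)

lemma continuous_on_bounded_functional:
  fixes \<phi> :: "'a::real_normed_vector \<Rightarrow> real"
  assumes "linear \<phi>" "\<And>x. \<bar>\<phi> x\<bar> \<le> norm x"
  shows "continuous_on S \<phi>"
  by (rule linear_continuous_on[OF bounded_linear_intro[where K = 1]])
     (use assms in \<open>auto simp: linear_iff\<close>)

lemma L1_dual_sphereD:
  assumes "\<phi> \<in> L1_dual_sphere M" "f \<in> L1_set M"
  shows "g \<in> L1_set M \<Longrightarrow> \<phi> (\<lambda>t. f t + g t) = \<phi> f + \<phi> g"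
    and "g \<in> L1_set M \<Longrightarrow> \<phi> (\<lambda>t. f t - g t) = \<phi> f - \<phi> g"
    and "\<phi> (\<lambda>t. c *\<^sub>R f t) = c * \<phi> f"
    and "\<bar>\<phi> f\<bar> \<le> L1_norm M f"
proof -
  have add: "\<phi> (\<lambda>t. f t + g t) = \<phi> f + \<phi> g" if "f \<in> L1_set M" "g \<in> L1_set M" for f g
    using assms(1) that by (simp add: dual_sphere_def)
  have sc: "\<phi> (\<lambda>t. c *\<^sub>R f t) = c * \<phi> f" if "f \<in> L1_set M" for c f
    using assms(1) that by (simp add: dual_sphere_def)
  show "\<bar>\<phi> f\<bar> \<le> L1_norm M f" using assms by (simp add: dual_sphere_def)
  show "\<phi> (\<lambda>t. c *\<^sub>R f t) = c * \<phi> f" using assms sc by blast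
  show "\<phi> (\<lambda>t. f t + g t) = \<phi> f + \<phi> g" if "g \<in> L1_set M" using assms add that by blast
  show "\<phi> (\<lambda>t. f t - g t) = \<phi> f - \<phi> g" if "g \<in> L1_set M"
    using add[OF assms(2) L1_set_scaleR[OF that, of "-1"]] sc[OF that, of "-1"] by simp
qed

text \<open>The property is applied to the unit directions of \<open>a\<close> and \<open>b\<close>
  and the result is scaled by their norms. It then holds for all pairs of vectors and can be used
  pointwise for the values of two simple functions. The inequalities are weak because a norm may be
  zero, in which case \<open>x0\<close> stands in for the direction.\<close>

lemma prop_star_homogeneous:
  fixes a b x0 :: "'a::real_normed_vector"
  assumes ps: "prop_star TYPE('a)" and x0: "norm x0 = 1" and "\<delta> > 0"
  shows "\<exists>\<psi>\<in>dual_sphere UNIV (+) (*\<^sub>R) norm. \<exists>u v. \<psi> a \<ge> (1 - \<delta>) * norm a \<and>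
    norm u \<le> norm b \<and> norm v \<le> norm b \<and> \<psi> u \<ge> (1 - \<delta>) * norm b \<and> \<psi> v \<ge> (1 - \<delta>) * norm b \<and>
    norm (b - u) + norm (b + v) \<le> (2 + \<delta>) * norm b"
proof -
  define dir where "dir z = (if z = 0 then x0 else sgn z)" for z :: 'a
  have dir: "norm (dir z) = 1" "z = norm z *\<^sub>R dir z" for z
    using x0 by (simp_all add: dir_def norm_sgn sgn_div_norm)
  obtain \<psi> g h where \<psi>: "\<psi> \<in> dual_sphere UNIV (+) (*\<^sub>R) norm" and a: "\<psi> (dir a) > 1 - \<delta>"
    and gh: "norm g \<le> 1" "norm h \<le> 1" "\<psi> g > 1 - \<delta>" "\<psi> h > 1 - \<delta>"
      "norm (dir b - g) + norm (dir b + h) < 2 + \<delta>"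
    using ps dir(1)[of a] dir(1)[of b] \<open>\<delta> > 0\<close> unfolding prop_star_iff by blast
  have sc: "\<psi> (c *\<^sub>R x) = c * \<psi> x" for c x
    using \<psi> by (simp add: dual_sphere_def)
  have "\<psi> a = norm a * \<psi> (dir a)" using sc dir(2) by metis
  then have 1: "\<psi> a \<ge> (1 - \<delta>) * norm a"
    using a mult_left_mono[of "1 - \<delta>" "\<psi> (dir a)" "norm a"] by (simp add: mult.commute)
  have "b - norm b *\<^sub>R g = norm b *\<^sub>R (dir b - g)" "b + norm b *\<^sub>R h = norm b *\<^sub>R (dir b + h)"
    using dir(2)[of b] by (simp_all add: scaleR_diff_right scaleR_add_right)
  then have "norm (b - norm b *\<^sub>R g) + norm (b + norm b *\<^sub>R h)
      = norm b * (norm (dir b - g) + norm (dir b + h))"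
    by (simp add: distrib_left)
  also have "\<dots> \<le> norm b * (2 + \<delta>)"
    using gh(5) by (intro mult_left_mono) auto
  finally have 2: "norm (b - norm b *\<^sub>R g) + norm (b + norm b *\<^sub>R h) \<le> (2 + \<delta>) * norm b"
    by (simp add: mult.commute)
  show ?thesis
    using \<psi> 1 2 gh(1-4) mult_left_mono[of "1 - \<delta>" "\<psi> g" "norm b"]
      mult_left_mono[of "1 - \<delta>" "\<psi> h" "norm b"]
    by (intro bexI[of _ \<psi>] exI[of _ "norm b *\<^sub>R g"] exI[of _ "norm b *\<^sub>R h"])
      (auto simp: sc mult_left_le mult.commute)
qed

text \<open>Integrating \<open>\<bar>\<Psi> c x\<bar> \<le> norm x\<close> bounds the norm by 1. The
  lower bound is tested on near-norming vectors of \<open>\<Psi> (p t)\<close>, weighted by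
  \<open>norm (k t)\<close>; the purpose of \<open>k\<close> is to supply a density of total mass
  1.\<close>

lemma L1_functional_of_simple_family:
  fixes \<Psi> :: "'c \<Rightarrow> 'a::real_normed_vector \<Rightarrow> real"
  assumes p: "simple_function M p"
    and \<Psi>: "\<And>c. \<Psi> c \<in> dual_sphere UNIV (+) (*\<^sub>R) norm"
    and k: "k \<in> L1_set M" "L1_norm M k = 1"
  defines "\<phi> \<equiv> \<lambda>f. \<integral>t. \<Psi> (p t) (f t) \<partial>M"
  shows "\<phi> \<in> L1_dual_sphere M"
    and "f \<in> L1_set M \<Longrightarrow> integrable M (\<lambda>t. \<Psi> (p t) (f t))"
proof -
  have lin: "linear (\<Psi> c)" and le: "\<bar>\<Psi> c x\<bar> \<le> norm x" for c x
    using \<Psi>[of c] by (simp_all add: dual_sphere_UNIV_iff)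
  have int: "integrable M (\<lambda>t. \<Psi> (p t) (f t))" if f: "f \<in> L1_set M" for f
  proof (rule Bochner_Integration.integrable_bound)
    show "integrable M (\<lambda>t. norm (f t))" using f by (simp add: L1_set_iff)
    show "(\<lambda>t. \<Psi> (p t) (f t)) \<in> borel_measurable M"
      using f strongly_measurable_simple_family[OF _ p, of f \<Psi>]
        continuous_on_bounded_functional[OF lin le]
      by (simp add: L1_set_iff strongly_measurable_real)
    show "AE t in M. norm (\<Psi> (p t) (f t)) \<le> norm (norm (f t))"
      using le by simp
  qed
  then show "f \<in> L1_set M \<Longrightarrow> integrable M (\<lambda>t. \<Psi> (p t) (f t))" .
  have "\<exists>f\<in>L1_set M. L1_norm M f \<le> 1 \<and> \<phi> f > 1 - \<delta>" if "\<delta> > 0" for \<delta>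
  proof -
    have "\<exists>x. norm x \<le> 1 \<and> \<Psi> c x > 1 - \<delta> / 2" for c
      using \<Psi>[of c] that by (simp add: dual_sphere_UNIV_iff)
    then obtain W where W: "\<And>c. norm (W c) \<le> 1" "\<And>c. \<Psi> c (W c) > 1 - \<delta> / 2"
      by metis
    \<comment> \<open>Since \<open>W\<close> depends on the value \<open>p t\<close> and not on the
      point \<open>t\<close> itself, \<open>f\<close> is strongly measurable.\<close>
    define f where "f t = norm (k t) *\<^sub>R W (p t)" for t
    have nf: "norm (f t) \<le> norm (k t)" for t
      using W(1) by (simp add: f_def mult_left_le)
    have "strongly_measurable M f"
      unfolding f_def
      by (rule strongly_measurable_simple_family[OF _ p, where \<Phi> = "\<lambda>c x. norm x *\<^sub>R W c"])
         (use k in \<open>auto simp: L1_set_iff intro!: continuous_intros\<close>)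
    then have f: "f \<in> L1_set M"
      by (rule L1_set_dominated[where w = "\<lambda>t. norm (k t)"]) (use k nf in \<open>auto simp: L1_set_iff\<close>)
    have "L1_norm M f \<le> 1"
      using L1_norm_mono[OF f k(1) nf] k(2) by simp
    moreover have "(\<integral>t. (1 - \<delta> / 2) * norm (k t) \<partial>M) \<le> \<phi> f"
      unfolding \<phi>_def
    proof (rule integral_mono)
      show "(1 - \<delta> / 2) * norm (k t) \<le> \<Psi> (p t) (f t)" for t
        using mult_left_mono[OF less_imp_le[OF W(2)[of "p t"]], of "norm (k t)"]
        by (simp add: f_def linear_cmul[OF lin] mult.commute)
    qed (use int[OF f] k in \<open>auto simp: L1_set_iff\<close>)
    then have "1 - \<delta> / 2 \<le> \<phi> f"
      using k by (simp add: L1_norm_eq_integral)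
    ultimately show ?thesis using f that by (intro bexI[of _ f]) auto
  qed
  moreover have "\<bar>\<phi> f\<bar> \<le> L1_norm M f" if f: "f \<in> L1_set M" for f
  proof -
    have "\<bar>\<phi> f\<bar> \<le> (\<integral>t. \<bar>\<Psi> (p t) (f t)\<bar> \<partial>M)"
      unfolding \<phi>_def by (rule integral_abs_bound)
    also have "\<dots> \<le> (\<integral>t. norm (f t) \<partial>M)"
      using int[OF f] f le by (intro integral_mono) (auto simp: L1_set_iff)
    finally show ?thesis using f by (simp add: L1_norm_eq_integral)
  qed
  ultimately show "\<phi> \<in> L1_dual_sphere M"
    using int unfolding dual_sphere_def \<phi>_def
    by (simp add: linear_add[OF lin] linear_cmul[OF lin])
qed

lemma prop_star_imp_prop_star_L1:
  assumes ps: "prop_star TYPE('a::real_normed_vector)"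
  shows "prop_star_L1 M TYPE('a)"
  unfolding prop_star_L1_iff
proof (intro ballI impI allI)
  fix f1 f2 :: "'b \<Rightarrow> 'a" and \<epsilon> :: real
  assume f: "f1 \<in> L1_set M" "f2 \<in> L1_set M" "L1_norm M f1 = 1" "L1_norm M f2 = 1" and "\<epsilon> > 0"
  \<comment> \<open>Three errors \<open>\<delta>\<close> add up in the final distance estimate: one
    for each of the two replacements of \<open>f2\<close> by \<open>k2\<close>, and one from the
    homogeneous inequality.\<close>
  define \<delta> where "\<delta> = \<epsilon> / 4"
  have \<delta>: "\<delta> > 0" using \<open>\<epsilon> > 0\<close> by (simp add: \<delta>_def)
  have "\<exists>x::'a. norm x = 1"
  proof -
    have "\<exists>t. f1 t \<noteq> 0" 
    proof (rule ccontr)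
      assume "\<nexists>t. f1 t \<noteq> 0"
      then show False using f(3) by (simp add: L1_norm_def)
    qed
    then show ?thesis using norm_sgn by metis
  qed
  then obtain x0 :: 'a where x0: "norm x0 = 1" by blast
  obtain k1 where k1: "simple_function M k1" "k1 \<in> L1_set M" "L1_norm M k1 = 1"
      "L1_norm M (\<lambda>t. f1 t - k1 t) < \<delta>"
    using L1_simple_approx_unit[OF f(1,3) \<delta>] by blast
  obtain k2 where k2: "simple_function M k2" "k2 \<in> L1_set M" "L1_norm M k2 = 1"
      "L1_norm M (\<lambda>t. f2 t - k2 t) < \<delta>"
    using L1_simple_approx_unit[OF f(2,4) \<delta>] by blast
  \<comment> \<open>The choice is made once for each pair \<open>c\<close> of values, so
    \<open>\<Psi>\<close>, \<open>U\<close> and \<open>V\<close> composed with the simple function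
    \<open>p\<close> take finitely many values on the space.\<close>
  have "\<exists>\<psi> u v. \<psi> \<in> dual_sphere UNIV (+) (*\<^sub>R) norm \<and> \<psi> (fst c) \<ge> (1 - \<delta>) * norm (fst c) \<and>
    norm u \<le> norm (snd c) \<and> norm v \<le> norm (snd c) \<and>
    \<psi> u \<ge> (1 - \<delta>) * norm (snd c) \<and> \<psi> v \<ge> (1 - \<delta>) * norm (snd c) \<and>
    norm (snd c - u) + norm (snd c + v) \<le> (2 + \<delta>) * norm (snd c)" for c :: "'a \<times> 'a"
    using prop_star_homogeneous[OF ps x0 \<delta>] by blast
  then obtain \<Psi> U V where \<Psi>: "\<And>c::'a \<times> 'a. \<Psi> c \<in> dual_sphere UNIV (+) (*\<^sub>R) norm"
      "\<And>c. \<Psi> c (fst c) \<ge> (1 - \<delta>) * norm (fst c)"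
    and U: "\<And>c. norm (U c) \<le> norm (snd c)" "\<And>c. \<Psi> c (U c) \<ge> (1 - \<delta>) * norm (snd c)"
    and V: "\<And>c. norm (V c) \<le> norm (snd c)" "\<And>c. \<Psi> c (V c) \<ge> (1 - \<delta>) * norm (snd c)"
    and UV: "\<And>c. norm (snd c - U c) + norm (snd c + V c) \<le> (2 + \<delta>) * norm (snd c)"
    by metis
  define p where "p t = (k1 t, k2 t)" for t
  have p: "simple_function M p"
    unfolding p_def by (rule simple_function_Pair[OF k1(1) k2(1)])
  have pt [simp]: "fst (p t) = k1 t" "snd (p t) = k2 t" for t by (simp_all add: p_def)
  define \<phi> where "\<phi> f = (\<integral>t. \<Psi> (p t) (f t) \<partial>M)" for f
  have \<phi>: "\<phi> \<in> L1_dual_sphere M"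
    unfolding \<phi>_def by (rule L1_functional_of_simple_family(1)[OF p \<Psi>(1) k1(2,3)])
  have int: "integrable M (\<lambda>t. \<Psi> (p t) (f t))" if "f \<in> L1_set M" for f
    by (rule L1_functional_of_simple_family(2)[OF p \<Psi>(1) k1(2,3) that])
  \<comment> \<open>Pointwise near-attainment is integrated against a function of norm 1. This
    serves for \<open>k1\<close> itself, and for \<open>g\<close> and \<open>h\<close> compared with
    \<open>k2\<close>.\<close>
  have \<phi>_ge: "1 - \<delta> \<le> \<phi> f"
    if "f \<in> L1_set M" "k \<in> L1_set M" "L1_norm M k = 1"
      "\<And>t. (1 - \<delta>) * norm (k t) \<le> \<Psi> (p t) (f t)" for f and k :: "'b \<Rightarrow> 'a"
  proof -
    have "(\<integral>t. (1 - \<delta>) * norm (k t) \<partial>M) \<le> \<phi> f"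
      unfolding \<phi>_def using that int[OF that(1)]
      by (intro integral_mono) (auto simp: L1_set_iff)
    then show ?thesis using that by (simp add: L1_norm_eq_integral)
  qed
  define g where "g t = U (p t)" for t
  define h where "h t = V (p t)" for t
  have g: "g \<in> L1_set M" and h: "h \<in> L1_set M"
    unfolding g_def h_def
    by (rule L1_set_dominated[where w = "\<lambda>t. norm (k2 t)"];
        use k2 U(1)[of "p _"] V(1)[of "p _"] in \<open>simp add: L1_set_iff
          simple_imp_strongly_measurable[OF simple_function_compose1[OF p]]\<close>)+
  have "L1_norm M g \<le> L1_norm M k2"
    by (rule L1_norm_mono[OF g k2(2)]) (use U(1)[of "p _"] in \<open>simp add: g_def\<close>)
  then have ng: "L1_norm M g \<le> 1" using k2 by simp
  have "L1_norm M h \<le> L1_norm M k2"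
    by (rule L1_norm_mono[OF h k2(2)]) (use V(1)[of "p _"] in \<open>simp add: h_def\<close>)
  then have nh: "L1_norm M h \<le> 1" using k2 by simp
  have \<phi>g: "1 - \<delta> \<le> \<phi> g"
    by (rule \<phi>_ge[OF g k2(2,3)]) (use U(2)[of "p _"] in \<open>simp add: g_def\<close>)
  have \<phi>h: "1 - \<delta> \<le> \<phi> h"
    by (rule \<phi>_ge[OF h k2(2,3)]) (use V(2)[of "p _"] in \<open>simp add: h_def\<close>)
  have "1 - \<delta> \<le> \<phi> k1"
    by (rule \<phi>_ge[OF k1(2,2,3)]) (use \<Psi>(2)[of "p _"] in simp)
  moreover have "\<bar>\<phi> f1 - \<phi> k1\<bar> < \<delta>"
    using L1_dual_sphereD(2)[OF \<phi> f(1) k1(2)] L1_dual_sphereD(4)[OF \<phi> L1_set_diff[OF f(1) k1(2)]] k1(4)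
    by simp
  ultimately have \<phi>f: "1 - \<epsilon> < \<phi> f1"
    using \<open>\<epsilon> > 0\<close> unfolding \<delta>_def by linarith
  have kg: "(\<lambda>t. k2 t - g t) \<in> L1_set M" and kh: "(\<lambda>t. k2 t + h t) \<in> L1_set M"
    by (simp_all add: L1_set_diff L1_set_add g h k2)
  have "(\<integral>t. norm (k2 t - g t) + norm (k2 t + h t) \<partial>M) \<le> (\<integral>t. (2 + \<delta>) * norm (k2 t) \<partial>M)"
    using kg kh k2 UV[of "p _"] by (intro integral_mono) (simp_all add: L1_set_iff g_def h_def)
  moreover have "(\<integral>t. norm (k2 t - g t) + norm (k2 t + h t) \<partial>M)
      = (\<integral>t. norm (k2 t - g t) \<partial>M) + (\<integral>t. norm (k2 t + h t) \<partial>M)"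
    using kg kh by (intro Bochner_Integration.integral_add) (simp_all add: L1_set_iff)
  ultimately have "L1_norm M (\<lambda>t. k2 t - g t) + L1_norm M (\<lambda>t. k2 t + h t) \<le> 2 + \<delta>"
    using kg kh k2 by (simp add: L1_norm_eq_integral)
  moreover have "L1_norm M (\<lambda>t. f2 t - g t) \<le> \<delta> + L1_norm M (\<lambda>t. k2 t - g t)"
    using L1_norm_triangle[OF L1_set_diff[OF f(2) k2(2)] kg] k2(4) by simp
  moreover have "L1_norm M (\<lambda>t. f2 t + h t) \<le> \<delta> + L1_norm M (\<lambda>t. k2 t + h t)"
    using L1_norm_triangle[OF L1_set_diff[OF f(2) k2(2)] kh] k2(4) by simp
  ultimately have "L1_norm M (\<lambda>t. f2 t - g t) + L1_norm M (\<lambda>t. f2 t + h t) < 2 + \<epsilon>"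
    using \<open>\<epsilon> > 0\<close> by (simp add: \<delta>_def)
  moreover have "1 - \<epsilon> < \<phi> g" "1 - \<epsilon> < \<phi> h" using \<phi>g \<phi>h \<open>\<epsilon> > 0\<close> by (simp_all add: \<delta>_def)
  ultimately show "\<exists>\<phi>\<in>L1_dual_sphere M. 1 - \<epsilon> < \<phi> f1 \<and>
      (\<exists>g\<in>L1_set M. \<exists>h\<in>L1_set M. L1_norm M g \<le> 1 \<and> L1_norm M h \<le> 1 \<and>
        1 - \<epsilon> < \<phi> g \<and> 1 - \<epsilon> < \<phi> h \<and>
        L1_norm M (\<lambda>t. f2 t - g t) + L1_norm M (\<lambda>t. f2 t + h t) < 2 + \<epsilon>)"
    using \<phi> \<phi>f g h ng nh by blast
qed

section \<open>Normalised functionals and slice points in \<open>X\<close>\<close>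

lemma dual_sphere_normalize:
  fixes \<psi> :: "'a::real_normed_vector \<Rightarrow> real"
  assumes lin: "linear \<psi>" and le: "\<And>x. \<bar>\<psi> x\<bar> \<le> norm x" and x0: "norm x0 \<le> 1" "\<psi> x0 > 0"
  obtains \<phi> where "\<phi> \<in> dual_sphere UNIV (+) (*\<^sub>R) norm" "\<And>x. \<psi> x \<ge> 0 \<Longrightarrow> \<phi> x \<ge> \<psi> x"
proof -
  \<comment> \<open>\<open>n\<close> is the dual norm of \<open>\<psi>\<close>. As
    \<open>0 < n\<close> and \<open>n \<le> 1\<close>, dividing by it can only increase nonnegative
    values, so lower bounds for \<open>\<psi>\<close> survive the normalisation.\<close>
  define n where "n = Sup (\<psi> ` cball 0 1)"
  have \<psi>_le_1: "\<psi> x \<le> 1" if "norm x \<le> 1" for x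
    using le[of x] that by simp
  then have bdd: "bdd_above (\<psi> ` cball 0 1)"
    by (intro bdd_aboveI[of _ 1]) auto
  have n_ge: "\<psi> x \<le> n" if "norm x \<le> 1" for x
    unfolding n_def by (rule cSup_upper[OF _ bdd]) (use that in auto)
  have "n \<le> 1"
    unfolding n_def using \<psi>_le_1 by (intro cSup_least) auto
  have "n > 0" using n_ge[OF x0(1)] x0(2) by simp
  have \<psi>_le: "\<psi> x \<le> n * norm x" for x
  proof (cases "x = 0")
    case True
    then show ?thesis using linear_0[OF lin] by simp
  next
    case False
    then have "\<psi> x = norm x * \<psi> (sgn x)"
      by (simp add: linear_cmul[OF lin] sgn_div_norm)
    also have "\<dots> \<le> norm x * n"
      using n_ge[of "sgn x"] by (intro mult_left_mono) (auto simp: norm_sgn)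
    finally show ?thesis by (simp add: mult.commute)
  qed
  define \<phi> where "\<phi> x = \<psi> x / n" for x
  have "linear \<phi>"
    using lin by (simp add: \<phi>_def linear_iff add_divide_distrib)
  moreover have "\<bar>\<phi> x\<bar> \<le> norm x" for x
    using \<psi>_le[of x] \<psi>_le[of "-x"] \<open>n > 0\<close>
    by (simp add: \<phi>_def linear_neg[OF lin] abs_le_iff field_simps)
  moreover have "\<exists>x. norm x \<le> 1 \<and> \<phi> x > 1 - \<delta>" if "\<delta> > 0" for \<delta>
  proof -
    have "n * (1 - \<delta>) < n" using \<open>n > 0\<close> that by simp
    moreover have "\<psi> ` cball 0 1 \<noteq> {}" by simp
    ultimately obtain x where "norm x \<le> 1" "n * (1 - \<delta>) < \<psi> x"
      using less_cSupD[of "\<psi> ` cball 0 1" "n * (1 - \<delta>)"]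
      unfolding n_def[symmetric] image_iff mem_cball_0 Bex_def by blast
    then show ?thesis
      using \<open>n > 0\<close> by (intro exI[of _ x]) (simp add: \<phi>_def less_divide_eq mult.commute)
  qed
  moreover have "\<phi> x \<ge> \<psi> x" if "\<psi> x \<ge> 0" for x
    using that \<open>n > 0\<close> \<open>n \<le> 1\<close> by (simp add: \<phi>_def le_divide_eq mult_left_le)
  ultimately show ?thesis using that[of \<phi>] by (simp add: dual_sphere_UNIV_iff)
qed

text \<open>Since \<open>\<psi>\<close> almost attains its norm at \<open>G\<close>,
  \<open>H = G - x2\<close> and \<open>x1\<close>, adding to \<open>G\<close> and \<open>H\<close>
  the multiples of \<open>x1\<close> that fill up their missing norm gives vectors \<open>u\<close>
  and \<open>v\<close> with \<open>\<psi>\<close> close to at least 1. As \<open>x2 - u\<close> is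
  \<open>- H\<close> minus a multiple of \<open>x1\<close> and \<open>x2 + v\<close> is
  \<open>G\<close> plus one, the two distances add up to about
  \<open>(norm G + p) + (norm H + q)\<close>, which is about 2.\<close>

lemma slice_points_of_approx_support:
  fixes \<psi> :: "'a::real_normed_vector \<Rightarrow> real"
  assumes lin: "linear \<psi>" and le: "\<And>x. \<bar>\<psi> x\<bar> \<le> norm x"
    and \<delta>: "0 \<le> \<delta>" "\<delta> \<le> 1/2"
    and x1: "norm x1 = 1" "\<psi> x1 \<ge> 1 - \<delta>" and x2: "\<psi> x2 \<ge> - \<delta>"
    and G: "norm G \<le> 1 + \<delta>" "\<psi> G \<ge> norm G - \<delta>" "norm (G - x2) \<le> \<psi> (G - x2) + \<delta>"
  shows "\<exists>u v. norm u \<le> 1 \<and> norm v \<le> 1 \<and> \<psi> u \<ge> 1 - 5 * \<delta> \<and> \<psi> v \<ge> 1 - 5 * \<delta> \<and>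
    norm (x2 - u) + norm (x2 + v) \<le> 2 + 12 * \<delta>"
proof -
  define H where "H = G - x2"
  define p where "p = max 0 (1 - norm G)"
  define q where "q = max 0 (1 - norm H)"
  \<comment> \<open>The norms of \<open>u\<close> and \<open>v\<close> can exceed 1 by up to
    \<open>3 * \<delta>\<close>; the factor \<open>c\<close> brings them back into the unit
    ball.\<close>
  define c where "c = 1 / (1 + 3 * \<delta>)"
  define u where "u = G + p *\<^sub>R x1"
  define v where "v = H + q *\<^sub>R x1"
  have \<psi>H: "\<psi> H = \<psi> G - \<psi> x2" by (simp add: H_def linear_diff[OF lin])
  have H: "norm H \<le> \<psi> H + \<delta>" using G(3) by (simp add: H_def)
  \<comment> \<open>The lower bound on \<open>\<psi> x2\<close> enters here: \<open>norm H\<close>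
    is controlled by \<open>\<psi> G - \<psi> x2\<close>.\<close>
  have H1: "norm H \<le> 1 + 3 * \<delta>" using H G x2 le[of G] by (simp add: \<psi>H)
  have p: "0 \<le> p" "p \<le> 1" "1 \<le> norm G + p" "norm G + p \<le> 1 + \<delta>"
    using G(1) \<delta> by (auto simp: p_def)
  have q: "0 \<le> q" "q \<le> 1" "1 \<le> norm H + q" "norm H + q \<le> 1 + 3 * \<delta>"
    using H1 \<delta> by (auto simp: q_def)
  have c: "0 < c" "c \<le> 1" "1 - 3 * \<delta> \<le> c" "(1 - c) * (1 + 3 * \<delta>) = 3 * \<delta>" "c * (1 + 3 * \<delta>) = 1"
    using \<delta> by (auto simp: c_def field_simps)
  \<comment> \<open>Shrinking by \<open>c\<close> moves \<open>w\<close> by at most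
    \<open>3 * \<delta>\<close> and keeps the functional value above
    \<open>(1 - 3 * \<delta>) * (1 - 2 * \<delta>)\<close>.\<close>
  have near: "1 - 5 * \<delta> \<le> \<psi> (c *\<^sub>R w) \<and> norm (c *\<^sub>R w) \<le> 1 \<and> norm (w - c *\<^sub>R w) \<le> 3 * \<delta>"
    if "norm w \<le> 1 + 3 * \<delta>" "1 - 2 * \<delta> \<le> \<psi> w" for w
  proof (intro conjI)
    have "1 - 5 * \<delta> \<le> 1 - 5 * \<delta> + 6 * (\<delta> * \<delta>)" by simp
    also have "\<dots> = (1 - 3 * \<delta>) * (1 - 2 * \<delta>)" by (simp add: algebra_simps)
    also have "\<dots> \<le> c * (1 - 2 * \<delta>)"
      using c \<delta> by (intro mult_right_mono) auto
    also have "\<dots> \<le> c * \<psi> w" using c that by (intro mult_left_mono) auto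
    finally show "1 - 5 * \<delta> \<le> \<psi> (c *\<^sub>R w)"
      by (simp add: linear_cmul[OF lin])
    show "norm (c *\<^sub>R w) \<le> 1"
      using mult_left_mono[OF that(1), of c] c by simp
    have "w - c *\<^sub>R w = (1 - c) *\<^sub>R w" by (simp add: scaleR_diff_left)
    then show "norm (w - c *\<^sub>R w) \<le> 3 * \<delta>"
      using mult_left_mono[OF that(1), of "1 - c"] c by simp
  qed
  have px: "p * (1 - \<delta>) \<le> p * \<psi> x1" and qx: "q * (1 - \<delta>) \<le> q * \<psi> x1"
    using p q x1 by (auto intro: mult_left_mono)
  have "p * \<delta> \<le> \<delta>" "q * \<delta> \<le> \<delta>" using p q \<delta> by (auto intro: mult_left_le_one_le)
  then have \<psi>u: "1 - 2 * \<delta> \<le> \<psi> u" and \<psi>v: "1 - 2 * \<delta> \<le> \<psi> v"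
    using px qx p q G(2) H
    by (simp_all add: u_def v_def linear_add[OF lin] linear_cmul[OF lin] right_diff_distrib)
  have nu: "norm u \<le> 1 + 3 * \<delta>" and nv: "norm v \<le> 1 + 3 * \<delta>"
    using norm_triangle_ineq[of G "p *\<^sub>R x1"] norm_triangle_ineq[of H "q *\<^sub>R x1"] p q x1 \<delta>
    by (simp_all add: u_def v_def)
  have "x2 - u = - H - p *\<^sub>R x1" "x2 + v = G + q *\<^sub>R x1" by (simp_all add: u_def v_def H_def)
  then have "norm (x2 - u) \<le> norm H + p" "norm (x2 + v) \<le> norm G + q"
    using norm_triangle_ineq4[of "- H" "p *\<^sub>R x1"] norm_triangle_ineq[of G "q *\<^sub>R x1"] x1 p q
    by simp_all
  moreover have "norm (x2 - c *\<^sub>R u) \<le> norm (x2 - u) + norm (u - c *\<^sub>R u)"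
    using norm_triangle_ineq[of "x2 - u" "u - c *\<^sub>R u"] by simp
  moreover have "norm (x2 + c *\<^sub>R v) \<le> norm (x2 + v) + norm (v - c *\<^sub>R v)"
    using norm_triangle_ineq4[of "x2 + v" "v - c *\<^sub>R v"] by simp
  moreover have "\<psi> H \<le> norm H" "\<psi> G \<le> norm G" using le[of H] le[of G] by auto
  ultimately have "norm (x2 - c *\<^sub>R u) + norm (x2 + c *\<^sub>R v) \<le> 2 + 12 * \<delta>"
    using near[OF nu \<psi>u] near[OF nv \<psi>v] H G(2) p q \<psi>H by linarith
  then show ?thesis using near[OF nu \<psi>u] near[OF nv \<psi>v] by blast
qed

section \<open>Averaging over the level sets of a simple function\<close>

lemma L1_sum:
  fixes f :: "'c \<Rightarrow> 'b \<Rightarrow> 'a::real_normed_vector"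
  assumes \<phi>: "\<phi> \<in> L1_dual_sphere M" and "finite Y" "\<And>y. y \<in> Y \<Longrightarrow> f y \<in> L1_set M"
  shows "(\<lambda>t. \<Sum>y\<in>Y. f y t) \<in> L1_set M \<and> \<phi> (\<lambda>t. \<Sum>y\<in>Y. f y t) = (\<Sum>y\<in>Y. \<phi> (f y))"
  using assms(2,3)
proof (induction Y rule: finite_induct)
  case empty
  have "(\<lambda>t. 0 :: 'a) \<in> L1_set M"
    by (rule L1_set_dominated[where w = "\<lambda>t. 0"]) (simp_all add: simple_imp_strongly_measurable)
  then show ?case using L1_dual_sphereD(3)[OF \<phi>, of "\<lambda>t. 0" 0] by simp
next
  case (insert y Y)
  then show ?case
    using L1_set_add[of "f y" M "\<lambda>t. \<Sum>y\<in>Y. f y t"]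
      L1_dual_sphereD(1)[OF \<phi>, of "f y" "\<lambda>t. \<Sum>y\<in>Y. f y t"]
    by simp
qed

lemma L1_norm_indicator_const:
  assumes "A \<in> sets M" "emeasure M A < \<infinity>"
  shows "L1_norm M (\<lambda>t. indicator A t *\<^sub>R x) = measure M A * norm x"
  using assms L1_set_simple_indicator[OF simple_function_const assms, of x]
  by (simp add: L1_norm_eq_integral Int_absorb2 sets.sets_into_space)

text \<open>The sets \<open>B y\<close> partition \<open>A\<close>, so the function is a finite sum
  of disjointly supported pieces. A general \<open>F\<close> allows constants, \<open>g\<close> and
  its translates to be split along the same partition.\<close>

lemma L1_simple_decomposition:
  fixes F :: "'c \<Rightarrow> 'a::real_normed_vector"
  assumes \<phi>: "\<phi> \<in> L1_dual_sphere M" and g: "simple_function M g"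
    and A: "A \<in> sets M" "emeasure M A < \<infinity>"
  defines "B \<equiv> \<lambda>y. A \<inter> (g -` {y} \<inter> space M)"
  shows "L1_norm M (\<lambda>t. indicator A t *\<^sub>R F (g t)) = (\<Sum>y\<in>g ` space M. measure M (B y) * norm (F y))"
    and "\<phi> (\<lambda>t. indicator A t *\<^sub>R F (g t)) = (\<Sum>y\<in>g ` space M. \<phi> (\<lambda>t. indicator (B y) t *\<^sub>R F y))"
proof -
  have B: "B y \<in> sets M" "emeasure M (B y) < \<infinity>" for y
  proof -
    show "B y \<in> sets M"
      unfolding B_def using A simple_functionD(2)[OF g] by blast
    have "emeasure M (B y) \<le> emeasure M A" unfolding B_def using A by (intro emeasure_mono) auto
    then show "emeasure M (B y) < \<infinity>" using A(2) by (rule le_less_trans)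
  qed
  have fin: "finite (g ` space M)" using g by (simp add: simple_function_def)
  \<comment> \<open>At most one summand is nonzero. An arbitrary \<open>h\<close> vanishing at 0
    covers both the vectors and their norms.\<close>
  have pt: "h (indicator A t) (g t) = (\<Sum>y\<in>g ` space M. h (indicator (B y) t) y)"
    if h: "\<And>y. h 0 y = 0" for h :: "real \<Rightarrow> 'c \<Rightarrow> 'd::comm_monoid_add" and t
  proof (cases "t \<in> A")
    case True
    then have t: "t \<in> space M" using A(1) sets.sets_into_space by blast
    have "(\<Sum>y\<in>g ` space M. h (indicator (B y) t) y)
        = (\<Sum>y\<in>g ` space M. if y = g t then h 1 (g t) else 0)"
      using True t by (intro sum.cong) (auto simp: B_def h indicator_def)
    then show ?thesis using True t fin by simp
  next
    case False
    then show ?thesis by (simp add: B_def h)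
  qed
  have e: "(\<lambda>t. indicator (B y) t *\<^sub>R F y) \<in> L1_set M" for y
    by (rule L1_set_simple_indicator[OF simple_function_const B])
  have eq: "(\<lambda>t. indicator A t *\<^sub>R F (g t)) = (\<lambda>t. \<Sum>y\<in>g ` space M. indicator (B y) t *\<^sub>R F y)"
    using pt[of "\<lambda>r y. r *\<^sub>R F y"] by (intro ext) simp
  note sum = L1_sum[OF \<phi> fin, of "\<lambda>y t. indicator (B y) t *\<^sub>R F y", OF e]
  show "\<phi> (\<lambda>t. indicator A t *\<^sub>R F (g t)) = (\<Sum>y\<in>g ` space M. \<phi> (\<lambda>t. indicator (B y) t *\<^sub>R F y))"
    unfolding eq using sum by blast
  have "(\<lambda>t. indicator A t *\<^sub>R F (g t)) \<in> L1_set M"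
    unfolding eq using sum by blast
  then have "L1_norm M (\<lambda>t. indicator A t *\<^sub>R F (g t)) = (\<integral>t. norm (indicator A t *\<^sub>R F (g t)) \<partial>M)"
    by (rule L1_norm_eq_integral)
  also have "\<dots> = (\<integral>t. (\<Sum>y\<in>g ` space M. norm (indicator (B y) t *\<^sub>R F y)) \<partial>M)"
    using pt[of "\<lambda>r y. norm (r *\<^sub>R F y)"] by simp
  also have "\<dots> = (\<Sum>y\<in>g ` space M. \<integral>t. norm (indicator (B y) t *\<^sub>R F y) \<partial>M)"
    using e by (intro Bochner_Integration.integral_sum) (simp only: L1_set_iff)
  also have "\<dots> = (\<Sum>y\<in>g ` space M. measure M (B y) * norm (F y))"
    by (simp only: L1_norm_eq_integral[OF e, symmetric] L1_norm_indicator_const[OF B])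
  finally show "L1_norm M (\<lambda>t. indicator A t *\<^sub>R F (g t))
      = (\<Sum>y\<in>g ` space M. measure M (B y) * norm (F y))" .
qed

text \<open>The defect, norm minus functional, is additive over \<open>A\<close> and its complement
  and nonnegative on each, so restricting to \<open>A\<close> cannot increase it.\<close>

lemma L1_defect_indicator_le:
  assumes \<phi>: "\<phi> \<in> L1_dual_sphere M" and f: "f \<in> L1_set M" and A: "A \<in> sets M"
  shows "L1_norm M (\<lambda>t. indicator A t *\<^sub>R f t) - \<phi> (\<lambda>t. indicator A t *\<^sub>R f t) \<le> L1_norm M f - \<phi> f"
proof -
  let ?a = "\<lambda>t. indicator A t *\<^sub>R f t" and ?b = "\<lambda>t. f t - indicator A t *\<^sub>R f t"
  have a: "?a \<in> L1_set M" by (rule L1_set_indicator[OF f A])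
  have b: "?b \<in> L1_set M" by (rule L1_set_diff[OF f a])
  have "(\<integral>t. norm (f t) \<partial>M) = (\<integral>t. norm (?a t) + norm (?b t) \<partial>M)"
    by (intro Bochner_Integration.integral_cong) (auto simp: indicator_def)
  also have "\<dots> = (\<integral>t. norm (?a t) \<partial>M) + (\<integral>t. norm (?b t) \<partial>M)"
    using a b by (intro Bochner_Integration.integral_add) (simp_all only: L1_set_iff)
  finally have "L1_norm M f = L1_norm M ?a + L1_norm M ?b"
    by (simp only: L1_norm_eq_integral a b f)
  then show ?thesis
    using L1_dual_sphereD(2)[OF \<phi> f a] L1_dual_sphereD(4)[OF \<phi> b] by simp
qed

text \<open>One pigeonhole over the levels of \<open>g\<close> has to give a norm bound and three
  small defects at once. The norm and the defects are therefore merged into a single sum, the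
  defects with weight \<open>K\<close>; a level where this sum is at most its average supplies
  \<open>\<psi>\<close> and \<open>G\<close>.\<close>

lemma L1_prop_star_imp_approx_support:
  fixes x1 x2 :: "'a::real_normed_vector"
  assumes ps: "prop_star_L1 M TYPE('a)"
    and A: "A \<in> sets M" "0 < emeasure M A" "emeasure M A < \<infinity>"
    and x1: "norm x1 = 1" and x2: "norm x2 = 1" and \<eta>: "0 < \<eta>" "\<eta> \<le> 1"
  shows "\<exists>\<psi> G. linear \<psi> \<and> (\<forall>x. \<bar>\<psi> x\<bar> \<le> norm x) \<and> 1 - \<eta> \<le> \<psi> x1 \<and>
    norm G \<le> 1 + \<eta> \<and> norm G - \<eta> \<le> \<psi> G \<and> norm (G - x2) \<le> \<psi> (G - x2) + \<eta>"
proof -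
  define m where "m = measure M A"
  have m: "m > 0" using A by (simp add: m_def measure_def enn2real_positive_iff)
  define f1 where "f1 t = indicator A t *\<^sub>R ((1 / m) *\<^sub>R x1)" for t
  define f2 where "f2 t = indicator A t *\<^sub>R ((1 / m) *\<^sub>R x2)" for t
  have f: "f1 \<in> L1_set M" "f2 \<in> L1_set M" "L1_norm M f1 = 1" "L1_norm M f2 = 1"
    unfolding f1_def f2_def L1_norm_indicator_const[OF A(1,3)]
    by (rule L1_set_simple_indicator[OF simple_function_const A(1,3)])+
      (use m x1 x2 in \<open>simp_all flip: m_def\<close>)
  \<comment> \<open>Quadratic in \<open>\<eta>\<close>, because the errors are later multiplied by
    \<open>K = 2 / \<eta>\<close> and must still stay below \<open>\<eta> / 2\<close>.\<close>
  define \<rho> where "\<rho> = \<eta>\<^sup>2 / 40"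
  have \<rho>: "\<rho> > 0" using \<eta> by (simp add: \<rho>_def)
  obtain \<phi> g0 h0 where \<phi>: "\<phi> \<in> L1_dual_sphere M" and \<phi>f1: "\<phi> f1 > 1 - \<rho>"
    and gh0: "g0 \<in> L1_set M" "h0 \<in> L1_set M" "L1_norm M g0 \<le> 1" "\<phi> g0 > 1 - \<rho>" "\<phi> h0 > 1 - \<rho>"
      "L1_norm M (\<lambda>t. f2 t - g0 t) + L1_norm M (\<lambda>t. f2 t + h0 t) < 2 + \<rho>"
    using ps f \<rho> unfolding prop_star_L1_iff by meson
  obtain g where g: "simple_function M g" "g \<in> L1_set M" "L1_norm M (\<lambda>t. g0 t - g t) < \<rho>"
    using L1_simple_approx[OF gh0(1) \<rho>] by blast
  have gg0: "(\<lambda>t. g t - g0 t) \<in> L1_set M" "(\<lambda>t. g0 t - f2 t) \<in> L1_set M" "(\<lambda>t. g t - f2 t) \<in> L1_set M"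
    using g gh0 f by (simp_all add: L1_set_diff)
  have dist: "L1_norm M (\<lambda>t. g t - g0 t) < \<rho>" using g(3) by (subst L1_norm_diff_commute)
  have "\<bar>\<phi> g - \<phi> g0\<bar> < \<rho>"
    using L1_dual_sphereD(2)[OF \<phi> g(2) gh0(1)] L1_dual_sphereD(4)[OF \<phi> gg0(1)] dist by simp
  moreover have ng: "L1_norm M g \<le> 1 + \<rho>"
    using L1_norm_triangle[OF gg0(1) gh0(1)] dist gh0(3) by simp
  moreover have "L1_norm M (\<lambda>t. g t - f2 t) \<le> \<rho> + L1_norm M (\<lambda>t. f2 t - g0 t)"
    using L1_norm_triangle[OF gg0(1,2)] dist L1_norm_diff_commute[of M g0 f2] by simp
  moreover have "\<phi> f2 + \<phi> h0 \<le> L1_norm M (\<lambda>t. f2 t + h0 t)"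
    using L1_dual_sphereD(1)[OF \<phi> f(2) gh0(2)] L1_dual_sphereD(4)[OF \<phi> L1_set_add[OF f(2) gh0(2)]]
    by simp
  moreover have "\<phi> (\<lambda>t. g t - f2 t) = \<phi> g - \<phi> f2"
    by (rule L1_dual_sphereD(2)[OF \<phi> g(2) f(2)])
  \<comment> \<open>For the second bound, \<open>\<phi> f2 + \<phi> h0\<close> bounds the distance
    involving \<open>h0\<close> from below, which leaves at most about \<open>1 - \<phi> f2\<close>
    for \<open>norm (g - f2)\<close>; \<open>\<phi> (g - f2)\<close> is about the same.\<close>
  ultimately have def: "L1_norm M g - \<phi> g \<le> 3 * \<rho>"
      "L1_norm M (\<lambda>t. g t - f2 t) - \<phi> (\<lambda>t. g t - f2 t) \<le> 5 * \<rho>"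
    using gh0 by linarith+
  define B where "B y = A \<inter> (g -` {y} \<inter> space M)" for y
  define \<mu> where "\<mu> y = measure M (B y)" for y
  \<comment> \<open>\<open>e y\<close> embeds \<open>X\<close> into L1 as constants on one level
    set, so \<open>\<phi>\<close> composed with it is a functional on \<open>X\<close> of norm at
    most \<open>\<mu> y\<close>.\<close>
  define e where "e y x = (\<lambda>t. indicator (B y) t *\<^sub>R x)" for y and x :: 'a
  have B: "B y \<in> sets M" "emeasure M (B y) < \<infinity>" for y
  proof -
    show "B y \<in> sets M"
      unfolding B_def using A simple_functionD(2)[OF g(1)] by blast
    have "emeasure M (B y) \<le> emeasure M A" unfolding B_def using A by (intro emeasure_mono) auto
    then show "emeasure M (B y) < \<infinity>" using A(3) by (rule le_less_trans)
  qed
  have eL: "e y x \<in> L1_set M" for y x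
    unfolding e_def by (rule L1_set_simple_indicator[OF simple_function_const B])
  have e_norm: "L1_norm M (e y x) = \<mu> y * norm x" for y x
    unfolding e_def \<mu>_def by (rule L1_norm_indicator_const[OF B])
  have e_add: "\<phi> (e y (x + x')) = \<phi> (e y x) + \<phi> (e y x')" for y x x'
    using L1_dual_sphereD(1)[OF \<phi> eL eL, of y x y x'] by (simp add: e_def scaleR_add_right)
  have e_sc: "\<phi> (e y (c *\<^sub>R x)) = c * \<phi> (e y x)" for y c x
    using L1_dual_sphereD(3)[OF \<phi> eL, of c y x] by (simp add: e_def mult.commute)
  have e_le: "\<bar>\<phi> (e y x)\<bar> \<le> \<mu> y * norm x" for y x
    using L1_dual_sphereD(4)[OF \<phi> eL, of y x] by (simp add: e_norm)
  note dec = L1_simple_decomposition[OF \<phi> g(1) A(1,3), folded B_def, folded \<mu>_def e_def]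
  define Y where "Y = g ` space M"
  define loss where "loss y x = \<mu> y * norm x - \<phi> (e y x)" for y x
  define K where "K = 2 / \<eta>"
  have K: "K > 0" using \<eta> by (simp add: K_def)
  define R where "R y = \<mu> y * norm y +
    K * (loss y ((1 / m) *\<^sub>R x1) + loss y y + loss y (y - (1 / m) *\<^sub>R x2))" for y
  \<comment> \<open>\<open>1 + \<rho>\<close> bounds the norm of \<open>g\<close>, and
    \<open>9 * \<rho>\<close> is the sum of the three defects \<open>\<rho>\<close>,
    \<open>3 * \<rho>\<close> and \<open>5 * \<rho>\<close>.\<close>
  define C where "C = 1 + \<rho> + 9 * K * \<rho>"
  have sum_loss: "(\<Sum>y\<in>Y. loss y (F y)) = L1_norm M (\<lambda>t. indicator A t *\<^sub>R F (g t))
      - \<phi> (\<lambda>t. indicator A t *\<^sub>R F (g t))" for F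
    using dec[of F] by (simp add: loss_def Y_def sum_subtractf)
  have "(\<Sum>y\<in>Y. loss y ((1 / m) *\<^sub>R x1)) \<le> \<rho>"
    using sum_loss[of "\<lambda>_. (1 / m) *\<^sub>R x1", folded f1_def] f(3) \<phi>f1 by simp
  moreover have "(\<Sum>y\<in>Y. loss y y) \<le> 3 * \<rho>"
    using sum_loss[of "\<lambda>y. y"] L1_defect_indicator_le[OF \<phi> g(2) A(1)] def(1) by simp
  moreover have "(\<Sum>y\<in>Y. loss y (y - (1 / m) *\<^sub>R x2)) \<le> 5 * \<rho>"
  proof -
    have "(\<lambda>t. indicator A t *\<^sub>R (g t - (1 / m) *\<^sub>R x2)) = (\<lambda>t. indicator A t *\<^sub>R (g t - f2 t))"
      by (auto simp: f2_def indicator_def)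
    then show ?thesis
      using sum_loss[of "\<lambda>y. y - (1 / m) *\<^sub>R x2"] L1_defect_indicator_le[OF \<phi> gg0(3) A(1)] def(2)
      by simp
  qed
  ultimately have "(\<Sum>y\<in>Y. loss y ((1 / m) *\<^sub>R x1) + loss y y + loss y (y - (1 / m) *\<^sub>R x2)) \<le> 9 * \<rho>"
    by (simp add: sum.distrib)
  then have "K * (\<Sum>y\<in>Y. loss y ((1 / m) *\<^sub>R x1) + loss y y + loss y (y - (1 / m) *\<^sub>R x2)) \<le> K * (9 * \<rho>)"
    using K by (intro mult_left_mono) auto
  moreover have "(\<Sum>y\<in>Y. \<mu> y * norm y) \<le> 1 + \<rho>"
  proof -
    have "L1_norm M (\<lambda>t. indicator A t *\<^sub>R g t) \<le> L1_norm M g"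
      by (rule L1_norm_mono[OF L1_set_indicator[OF g(2) A(1)] g(2)]) (simp add: indicator_def)
    then show ?thesis using dec(1)[of "\<lambda>y. y"] ng by (simp add: Y_def)
  qed
  ultimately have sumR: "(\<Sum>y\<in>Y. R y) \<le> C"
    by (simp add: R_def C_def sum.distrib flip: sum_distrib_left)
  have fin: "finite Y" using g(1) by (simp add: Y_def simple_function_def)
  have sum\<mu>: "(\<Sum>y\<in>Y. \<mu> y) = m"
    using dec(1)[of "\<lambda>_. x1"] L1_norm_indicator_const[OF A(1,3), of x1] x1 by (simp add: Y_def m_def)
  have \<mu>_nonneg: "\<mu> y \<ge> 0" for y by (simp add: \<mu>_def)
  \<comment> \<open>Otherwise summing contradicts the bound \<open>C\<close>. On a null level every
    term of \<open>R y\<close> vanishes, so the reverse inequality holds there too, and it is strict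
    on some level because the \<open>\<mu> y\<close> add up to \<open>m > 0\<close>.\<close>
  have "\<exists>y\<in>Y. \<mu> y > 0 \<and> R y \<le> C * (\<mu> y / m)"
  proof (rule ccontr)
    assume "\<not> ?thesis"
    then have less: "C * (\<mu> y / m) < R y" if "y \<in> Y" "\<mu> y > 0" for y using that by force
    have "C * (\<mu> y / m) \<le> R y" if "y \<in> Y" for y
    proof (cases "\<mu> y = 0")
      case True
      then show ?thesis using e_le[of y] by (simp add: R_def loss_def)
    next
      case False
      then show ?thesis using less[OF that] \<mu>_nonneg[of y] by simp
    qed
    moreover have "\<exists>y\<in>Y. \<mu> y > 0"
      using sum\<mu> m \<mu>_nonneg sum_pos2 by (metis less_eq_real_def less_irrefl sum.neutral)
    ultimately have "(\<Sum>y\<in>Y. C * (\<mu> y / m)) < (\<Sum>y\<in>Y. R y)"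
      using less fin by (intro sum_strict_mono_ex1) auto
    moreover have "(\<Sum>y\<in>Y. C * (\<mu> y / m)) = C"
      using sum\<mu> m by (simp flip: sum_distrib_left sum_divide_distrib)
    ultimately show False using sumR by simp
  qed
  then obtain y where y: "y \<in> Y" "\<mu> y > 0" "R y \<le> C * (\<mu> y / m)" by blast
  define \<psi> where "\<psi> x = \<phi> (e y x) / \<mu> y" for x
  \<comment> \<open>The factor \<open>m\<close> undoes the scaling \<open>1 / m\<close> of the
    values of \<open>f1\<close> and \<open>f2\<close>.\<close>
  define G where "G = m *\<^sub>R y"
  have lin: "linear \<psi>" by (simp add: \<psi>_def linear_iff e_add e_sc add_divide_distrib)
  have le: "\<bar>\<psi> x\<bar> \<le> norm x" for x
    using e_le[of y x] y(2) by (simp add: \<psi>_def divide_le_eq mult.commute)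
  have loss: "loss y ((1 / m) *\<^sub>R x) = (\<mu> y / m) * (norm x - \<psi> x)" for x
    using m y(2) by (simp add: loss_def \<psi>_def e_sc field_simps)
  have yG: "y = (1 / m) *\<^sub>R G" "y - (1 / m) *\<^sub>R x2 = (1 / m) *\<^sub>R (G - x2)"
    using m by (simp_all add: G_def scaleR_diff_right)
  define D where "D = (1 - \<psi> x1) + (norm G - \<psi> G) + (norm (G - x2) - \<psi> (G - x2))"
  define w where "w = \<mu> y / m"
  have "loss y ((1 / m) *\<^sub>R x1) = w * (1 - \<psi> x1)"
    using loss[of x1] x1 by (simp add: w_def)
  moreover have "loss y y = w * (norm G - \<psi> G)"
    using loss[of G] yG(1) by (simp add: w_def)
  moreover have "loss y (y - (1 / m) *\<^sub>R x2) = w * (norm (G - x2) - \<psi> (G - x2))"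
    using loss[of "G - x2"] yG(2) by (simp add: w_def)
  moreover have "\<mu> y * norm y = w * norm G" using m by (simp add: G_def w_def)
  ultimately have "R y = w * norm G + K * (w * (1 - \<psi> x1) + w * (norm G - \<psi> G)
      + w * (norm (G - x2) - \<psi> (G - x2)))"
    by (simp only: R_def)
  also have "\<dots> = w * (norm G + K * D)" by (simp add: D_def algebra_simps)
  finally have "w * (norm G + K * D) \<le> w * C" using y(3) by (simp add: w_def mult.commute)
  moreover have "w > 0" using y(2) m by (simp add: w_def)
  ultimately have main: "norm G + K * D \<le> C" by (simp add: mult_le_cancel_left_pos)
  have parts: "0 \<le> 1 - \<psi> x1" "0 \<le> norm G - \<psi> G" "0 \<le> norm (G - x2) - \<psi> (G - x2)"
    using le[of x1] le[of G] le[of "G - x2"] x1 by auto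
  then have "0 \<le> D" by (simp add: D_def)
  have "\<eta>\<^sup>2 \<le> \<eta>" using \<eta> by (simp add: power2_eq_square mult_left_le)
  moreover have "9 * K * \<rho> = 18 / 40 * \<eta>" using \<eta> by (simp add: K_def \<rho>_def power2_eq_square)
  ultimately have C: "C \<le> 1 + \<eta> / 2" using \<eta> by (simp add: C_def \<rho>_def)
  have "0 \<le> K * D" using K \<open>0 \<le> D\<close> by simp
  then have "norm G \<le> 1 + \<eta>" using main C \<eta> by simp
  \<comment> \<open>The weight pays off: \<open>K * D \<le> C \<le> 2\<close> with
    \<open>K = 2 / \<eta>\<close>.\<close>
  moreover have "D \<le> \<eta>"
  proof -
    have "K * D \<le> 2" using main C \<eta> norm_ge_zero[of G] by linarith
    then show ?thesis using \<eta> by (simp add: K_def divide_le_eq)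
  qed
  then have "1 - \<eta> \<le> \<psi> x1" "norm G - \<eta> \<le> \<psi> G" "norm (G - x2) \<le> \<psi> (G - x2) + \<eta>"
    using parts by (simp_all add: D_def)
  ultimately show ?thesis using lin le by blast
qed

section \<open>From L1 back to \<open>X\<close>\<close>

lemma prop_star_L1_imp_slice_points:
  fixes x1 x2 :: "'a::real_normed_vector"
  assumes ps: "prop_star_L1 M TYPE('a)"
    and A: "A \<in> sets M" "0 < emeasure M A" "emeasure M A < \<infinity>"
    and x1: "norm x1 = 1" and x2: "norm x2 = 1" and "\<epsilon> > 0"
    and \<tau>: "0 < \<tau>" "\<tau> \<le> \<epsilon> / 80" "\<tau> \<le> 1 / 20" "norm (x1 + \<tau> *\<^sub>R x2) \<ge> 1"
  shows "\<exists>\<phi>\<in>dual_sphere UNIV (+) (*\<^sub>R) norm. \<phi> x1 > 1 - \<epsilon> \<and>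
    (\<exists>g h. norm g \<le> 1 \<and> norm h \<le> 1 \<and> \<phi> g > 1 - \<epsilon> \<and> \<phi> h > 1 - \<epsilon> \<and>
      norm (x2 - g) + norm (x2 + h) < 2 + \<epsilon>)"
proof -
  \<comment> \<open>\<open>\<delta>\<close> absorbs the loss \<open>\<eta> + \<tau>\<close> at
    \<open>x1\<close>, where \<open>\<eta> \<le> 2 * \<tau>\<close>, and
    \<open>\<tau> \<le> \<epsilon> / 80\<close> leaves room for the final error
    \<open>12 * \<delta>\<close>.\<close>
  define \<delta> where "\<delta> = 4 * \<tau>"
  have \<delta>: "0 < \<delta>" "\<delta> \<le> 1/5" "20 * \<delta> \<le> \<epsilon>"
    using \<tau> by (simp_all add: \<delta>_def)
  \<comment> \<open>The bound \<open>\<tau> * \<psi> x2 \<ge> - \<eta>\<close> obtained below is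
    divided by \<open>\<tau>\<close>, hence the factor \<open>\<tau>\<close> in
    \<open>\<eta>\<close>.\<close>
  define \<eta> where "\<eta> = \<tau> * \<delta>"
  have "\<tau> * \<delta> \<le> 1 / 2 * \<delta>" using \<tau> \<delta> by (intro mult_right_mono) auto
  moreover have "\<tau> * \<delta> > 0" using \<tau> \<delta> by simp
  ultimately have \<eta>: "0 < \<eta>" "\<eta> \<le> \<delta> / 2" "\<eta> \<le> 1"
    using \<delta> unfolding \<eta>_def by linarith+
  define D where "D = norm (x1 + \<tau> *\<^sub>R x2)"
  \<comment> \<open>A functional almost norming the perturbed vector almost norms \<open>x1\<close>,
    as \<open>\<tau>\<close> is small, and cannot be very negative at \<open>x2\<close>, as its
    value at \<open>x1\<close> is at most 1.\<close>
  define x where "x = (1 / D) *\<^sub>R (x1 + \<tau> *\<^sub>R x2)"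
  have D: "D \<ge> 1" using \<tau> by (simp add: D_def)
  have "norm x = (1 / D) * D" unfolding x_def using D by (simp add: D_def)
  then have x: "norm x = 1" using D by simp
  have Dx: "D *\<^sub>R x = x1 + \<tau> *\<^sub>R x2" using D by (simp add: x_def)
  obtain \<psi> G where lin: "linear \<psi>" and le: "\<And>x. \<bar>\<psi> x\<bar> \<le> norm x" and "1 - \<eta> \<le> \<psi> x"
    and G: "norm G \<le> 1 + \<eta>" "norm G - \<eta> \<le> \<psi> G" "norm (G - x2) \<le> \<psi> (G - x2) + \<eta>"
    using L1_prop_star_imp_approx_support[OF ps A x x2 \<eta>(1,3)] by blast
  have "D * \<psi> x = \<psi> x1 + \<tau> * \<psi> x2"
    using Dx by (metis lin linear_add linear_cmul real_scaleR_def)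
  \<comment> \<open>Because \<open>D \<ge> 1\<close>, the lower bound at \<open>x\<close> passes to
    the vector \<open>D *\<^sub>R x\<close> before normalisation.\<close>
  moreover have "1 * (1 - \<eta>) \<le> D * \<psi> x"
    using D \<open>1 - \<eta> \<le> \<psi> x\<close> \<eta> \<delta> by (intro mult_mono) auto
  ultimately have sum: "1 - \<eta> \<le> \<psi> x1 + \<tau> * \<psi> x2" by simp
  have "\<tau> * \<psi> x2 \<le> \<tau>" using le[of x2] x2 \<tau> by (simp add: mult_left_le)
  then have \<psi>x1: "1 - \<delta> \<le> \<psi> x1" using sum \<eta> \<tau> unfolding \<delta>_def by linarith
  have "\<tau> * (- \<delta>) \<le> \<tau> * \<psi> x2" using sum le[of x1] x1 by (simp add: \<eta>_def)
  then have \<psi>x2: "- \<delta> \<le> \<psi> x2" using \<tau> mult_le_cancel_left_pos by blast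
  obtain u v where uv: "norm u \<le> 1" "norm v \<le> 1" "\<psi> u \<ge> 1 - 5 * \<delta>" "\<psi> v \<ge> 1 - 5 * \<delta>"
      "norm (x2 - u) + norm (x2 + v) \<le> 2 + 12 * \<delta>"
    using slice_points_of_approx_support[OF lin le _ _ x1 \<psi>x1 \<psi>x2, of G] G \<eta> \<delta> by force
  have "norm x1 \<le> 1" "0 < \<psi> x1" using x1 \<psi>x1 \<delta> by simp_all
  then obtain \<phi> where \<phi>: "\<phi> \<in> dual_sphere UNIV (+) (*\<^sub>R) norm" "\<And>x. \<psi> x \<ge> 0 \<Longrightarrow> \<phi> x \<ge> \<psi> x"
    using dual_sphere_normalize[OF lin le, of x1] by blast
  \<comment> \<open>\<open>\<delta> \<le> 1/5\<close> makes \<open>\<psi> u\<close> and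
    \<open>\<psi> v\<close> nonnegative, so \<open>\<phi>\<close> is at least as large
    there.\<close>
  have "1 - \<epsilon> < \<phi> x1" "1 - \<epsilon> < \<phi> u" "1 - \<epsilon> < \<phi> v"
    using \<phi>(2)[of x1] \<phi>(2)[of u] \<phi>(2)[of v] \<psi>x1 uv(3,4) \<delta> by linarith+
  moreover have "norm (x2 - u) + norm (x2 + v) < 2 + \<epsilon>" using uv(5) \<delta> by linarith
  ultimately show ?thesis using \<phi>(1) uv(1,2) by blast
qed

text \<open>The two perturbations of \<open>x1\<close>, towards \<open>x2\<close> and towards
  \<open>- x2\<close>, add up to twice \<open>x1\<close>, so one of them has norm at least
  1.\<close>

lemma prop_star_L1_imp_prop_star:
  assumes ps: "prop_star_L1 M TYPE('a::real_normed_vector)"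
    and A: "A \<in> sets M" "0 < emeasure M A" "emeasure M A < \<infinity>"
  shows "prop_star TYPE('a)"
  unfolding prop_star_iff
proof (intro allI impI)
  fix x1 x2 :: 'a and \<epsilon> :: real
  assume x: "norm x1 = 1" "norm x2 = 1" and "\<epsilon> > 0"
  define \<tau> where "\<tau> = min (\<epsilon> / 80) (1 / 20)"
  have \<tau>: "0 < \<tau>" "\<tau> \<le> \<epsilon> / 80" "\<tau> \<le> 1 / 20" using \<open>\<epsilon> > 0\<close> by (auto simp: \<tau>_def)
  note slice = prop_star_L1_imp_slice_points[OF ps A x(1) _ \<open>\<epsilon> > 0\<close> \<tau>]
  have "2 = norm ((x1 + \<tau> *\<^sub>R x2) + (x1 + \<tau> *\<^sub>R (- x2)))"
    using x by (simp flip: scaleR_2)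
  also have "\<dots> \<le> norm (x1 + \<tau> *\<^sub>R x2) + norm (x1 + \<tau> *\<^sub>R (- x2))" by (rule norm_triangle_ineq)
  finally consider "1 \<le> norm (x1 + \<tau> *\<^sub>R x2)" | "1 \<le> norm (x1 + \<tau> *\<^sub>R (- x2))" by linarith
  then show "\<exists>\<phi>\<in>dual_sphere UNIV (+) (*\<^sub>R) norm. 1 - \<epsilon> < \<phi> x1 \<and>
      (\<exists>g h. norm g \<le> 1 \<and> norm h \<le> 1 \<and> 1 - \<epsilon> < \<phi> g \<and> 1 - \<epsilon> < \<phi> h \<and>
        norm (x2 - g) + norm (x2 + h) < 2 + \<epsilon>)"
  proof cases
    case 1
    then show ?thesis by (rule slice[OF x(2)])
  next
    case 2
    \<comment> \<open>When \<open>x2\<close> changes sign the two slice points exchange roles, so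
      the result for \<open>- x2\<close> is the one for \<open>x2\<close>.\<close>
    have "norm (- x2 - g) + norm (- x2 + h) = norm (x2 - h) + norm (x2 + g)" for g h
      using norm_minus_cancel[of "x2 + g"] norm_minus_commute[of x2 h] by simp
    then show ?thesis using slice[of "- x2"] 2 x(2) by (simp only: norm_minus_cancel) blast
  qed
qed

section \<open>A set of finite positive measure, and the equivalence\<close>

lemma (in sigma_finite_measure) obtain_positive_finite_set:
  assumes "emeasure M (space M) > 0"
  obtains A where "A \<in> sets M" "0 < emeasure M A" "emeasure M A < \<infinity>"
proof -
  obtain A :: "nat \<Rightarrow> 'a set" where A: "range A \<subseteq> sets M" "(\<Union>i. A i) = space M"
      "\<And>i. emeasure M (A i) \<noteq> \<infinity>"
    using sigma_finite by blast
  have "\<exists>i. emeasure M (A i) \<noteq> 0"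
  proof (rule ccontr)
    assume "\<not> ?thesis"
    then have "emeasure M (\<Union>i. A i) = 0" using A(1) by (intro emeasure_UN_eq_0) auto
    then show False using A(2) assms by simp
  qed
  then obtain i where "emeasure M (A i) \<noteq> 0" by blast
  then show ?thesis
    using that[of "A i"] A(1) A(3)[of i] by (auto simp: zero_less_iff_neq_zero top.not_eq_extremum)
qed

theorem theorem2p7:
  fixes M :: "'b measure"
  assumes "sigma_finite_measure M"
    and "emeasure M (space M) > 0"
  shows "prop_star TYPE('a::banach) \<longleftrightarrow> prop_star_L1 M TYPE('a)"
proof -
  obtain A where "A \<in> sets M" "0 < emeasure M A" "emeasure M A < \<infinity>"
    using sigma_finite_measure.obtain_positive_finite_set[OF assms] .
  then show ?thesis
    using prop_star_imp_prop_star_L1 prop_star_L1_imp_prop_star by blast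
qed

end
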